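(* Let $e_1,e_2,e_3\in\mathbb{R}^d$ be three vectors and $N\subset\mathbb{R}^d$ a vector subspace. Let $\sigma:\mathbb{R}^d\to\mathbb{R}^d/N$ be the canonical surjection and $\tilde e_i:=\sigma(e_i)$ for $i\in\{1,2,3\}$. Then $e_1,e_2,e_3,N$ do not satisfy (BC) if and only if one of the following conditions is satisfied: \begin{itemize} \item $\tilde e_1=0$ or $\tilde e_2=0$; \item $(\tilde e_1,\tilde e_2)$ is a linearly independent family and $\tilde e_3=a\tilde e_1+b\tilde e_2$ with $ab\ge\frac14$; \item $\tilde e_2=\beta\tilde e_1$ with $\beta<0$; \item $\tilde e_2=\beta\tilde e_1$, $\tilde e_3=\gamma\tilde e_1$ with $\beta\le\gamma^2$ and $\beta\neq0$. \end{itemize}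
   Context: (BC): vectors $e_1,e_2,e_3\in\mathbb{R}^d$ and a vector subspace $N\subset\mathbb{R}^d$ are said to satisfy (BC) if there exists a linear form $\mathbb{P}:\mathbb{R}^d\to\mathbb{R}$ such that $\mathbb{P}|_N\equiv0$ and $\mathbb{P}(e_3)^2<\mathbb{P}(e_1)\mathbb{P}(e_2)$. *)

theory Defs
  imports "HOL-Analysis.Analysis"
begin

definition BC :: "real ^ 'n \<Rightarrow> real ^ 'n \<Rightarrow> real ^ 'n \<Rightarrow> (real ^ 'n) set \<Rightarrow> bool" where
  "BC e1 e2 e3 N \<longleftrightarrow>
     (\<exists>P :: real ^ 'n \<Rightarrow> real. linear P \<and> (\<forall>x\<in>N. P x = 0) \<and> (P e3)\<^sup>2 < P e1 * P e2)"

text \<open>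
  The quotient by a subspace \<open>N\<close> is modelled by cosets: its elements are the sets \<open>v +o N\<close>,
  its zero is \<open>N\<close>, and addition is the elementwise addition of sets from
  \<^theory>\<open>HOL-Library.Set_Algebras\<close>.  In the scalar multiplication, adding \<open>N\<close> matters only
  for the scalar \<open>0\<close>, where the elementwise multiple of a coset would be \<open>{0}\<close> instead of \<open>N\<close>.
\<close>

definition quot_proj :: "'a::real_vector set \<Rightarrow> 'a \<Rightarrow> 'a set" where
  "quot_proj N v = v +o N"

definition quot_scale :: "'a::real_vector set \<Rightarrow> real \<Rightarrow> 'a set \<Rightarrow> 'a set" where
  "quot_scale N a X = (\<lambda>x. a *\<^sub>R x) ` X + N"

definition quot_independent2 :: "'a::real_vector set \<Rightarrow> 'a set \<Rightarrow> 'a set \<Rightarrow> bool" where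
  "quot_independent2 N X Y \<longleftrightarrow>
     (\<forall>a b. quot_scale N a X + quot_scale N b Y = N \<longrightarrow> a = 0 \<and> b = 0)"

text \<open>\<open>quot_proj N\<close> is linear for these operations and has kernel \<open>N\<close>.\<close>

lemma quot_proj_eq_iff:
  assumes "subspace N"
  shows "quot_proj N v = quot_proj N w \<longleftrightarrow> v - w \<in> N"
proof
  assume eq: "quot_proj N v = quot_proj N w"
  have "v \<in> quot_proj N v"
    using subspace_0[OF assms] by (force simp: quot_proj_def elt_set_plus_def)
  then show "v - w \<in> N"
    by (auto simp: eq) (auto simp: quot_proj_def elt_set_plus_def)
next
  assume vw: "v - w \<in> N"
  have sub: "quot_proj N x \<subseteq> quot_proj N y" if "x - y \<in> N" for x y
  proof
    fix z assume "z \<in> quot_proj N x"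
    then obtain n where n: "n \<in> N" "z = x + n"
      by (auto simp: quot_proj_def elt_set_plus_def)
    then have "(x - y) + n \<in> N" "z = y + ((x - y) + n)"
      using that assms by (auto simp: subspace_add)
    then show "z \<in> quot_proj N y"
      unfolding quot_proj_def elt_set_plus_def by blast
  qed
  have "w - v \<in> N"
    using subspace_neg[OF assms vw] by simp
  with vw show "quot_proj N v = quot_proj N w"
    using sub by blast
qed

lemma quot_proj_0: "quot_proj N 0 = N"
  by (auto simp: quot_proj_def elt_set_plus_def)

lemma quot_proj_add:
  assumes "subspace N"
  shows "quot_proj N v + quot_proj N w = quot_proj N (v + w)"
proof
  show "quot_proj N v + quot_proj N w \<subseteq> quot_proj N (v + w)"
  proof
    fix z assume "z \<in> quot_proj N v + quot_proj N w"
    then obtain m n where "m \<in> N" "n \<in> N" "z = (v + m) + (w + n)"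
      by (auto simp: quot_proj_def elt_set_plus_def set_plus_def)
    then have "m + n \<in> N" "z = (v + w) + (m + n)"
      using assms by (auto simp: subspace_add)
    then show "z \<in> quot_proj N (v + w)"
      unfolding quot_proj_def elt_set_plus_def by blast
  qed
next
  show "quot_proj N (v + w) \<subseteq> quot_proj N v + quot_proj N w"
  proof
    fix z assume "z \<in> quot_proj N (v + w)"
    then obtain n where "n \<in> N" "z = (v + 0) + (w + n)"
      by (auto simp: quot_proj_def elt_set_plus_def add.assoc)
    then show "z \<in> quot_proj N v + quot_proj N w"
      using subspace_0[OF assms] unfolding quot_proj_def elt_set_plus_def set_plus_def by blast
  qed
qed

lemma quot_proj_scale:
  assumes "subspace N"
  shows "quot_scale N a (quot_proj N v) = quot_proj N (a *\<^sub>R v)"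
proof
  show "quot_scale N a (quot_proj N v) \<subseteq> quot_proj N (a *\<^sub>R v)"
  proof
    fix z assume "z \<in> quot_scale N a (quot_proj N v)"
    then obtain m n where "m \<in> N" "n \<in> N" "z = a *\<^sub>R (v + m) + n"
      by (auto simp: quot_scale_def quot_proj_def elt_set_plus_def set_plus_def)
    then have "a *\<^sub>R m + n \<in> N" "z = a *\<^sub>R v + (a *\<^sub>R m + n)"
      using assms by (auto simp: subspace_add subspace_scale scaleR_add_right)
    then show "z \<in> quot_proj N (a *\<^sub>R v)"
      unfolding quot_proj_def elt_set_plus_def by blast
  qed
next
  show "quot_proj N (a *\<^sub>R v) \<subseteq> quot_scale N a (quot_proj N v)"
  proof
    fix z assume "z \<in> quot_proj N (a *\<^sub>R v)"
    then obtain n where "n \<in> N" "z = a *\<^sub>R (v + 0) + n"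
      by (auto simp: quot_proj_def elt_set_plus_def)
    then show "z \<in> quot_scale N a (quot_proj N v)"
      using subspace_0[OF assms]
      unfolding quot_scale_def quot_proj_def elt_set_plus_def set_plus_def by blast
  qed
qed

end

theory Submission
  imports Defs
begin

text \<open>
  A linear form vanishing on \<open>N\<close> may take arbitrary values on vectors that are linearly
  independent modulo \<open>N\<close>.  So (BC) asks whether \<open>z\<^sup>2 < x y\<close> has a solution, where
  \<open>(x, y, z)\<close> satisfies the linear relations that \<open>e1, e2, e3\<close> satisfy modulo \<open>N\<close>.  The only case that
  is not immediate is \<open>z = a x + b y\<close> with \<open>x, y\<close> free: the quadratic form \<open>(a x + b y)\<^sup>2 - x y\<close>
  takes a negative value iff its discriminant \<open>1 - 4 a b\<close> is positive.
\<close>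

text \<open>A basis of \<open>span S\<close> taken inside \<open>S\<close> stays independent when
  \<open>v\<close> is added, so a linear map may follow \<open>f\<close> on this basis and still
  take any value at \<open>v\<close>. Repeated use builds forms that vanish on \<open>N\<close> with
  prescribed values at \<open>e1\<close>, \<open>e2\<close>, \<open>e3\<close>, one vector at a
  time.\<close>

lemma linear_extend_insert:
  fixes f :: "'a::real_vector \<Rightarrow> 'b::real_vector"
  assumes f: "linear f" and v: "v \<notin> span S"
  obtains g where "linear g" "\<And>x. x \<in> span S \<Longrightarrow> g x = f x" "g v = c"
proof -
  obtain B where B: "B \<subseteq> S" "independent B" "span S = span B"
    using maximal_independent_subset[of S] by (metis span_mono span_span subset_antisym)
  then have "independent (insert v B)"
    using v by (simp add: independent_insertI)
  then obtain g where g: "linear g" "\<forall>x\<in>insert v B. g x = (f(v := c)) x"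
    using linear_independent_extend by blast
  have "v \<notin> B"
    using v B span_base by metis
  then have "\<And>x. x \<in> B \<Longrightarrow> g x = f x"
    using g(2) by auto
  then have "\<And>x. x \<in> span B \<Longrightarrow> g x = f x"
    using linear_eq_on_span[OF g(1) f] by blast
  then show thesis
    using that[of g] g B(3) by auto
qed

lemma form_negative_iff:
  fixes a b :: real
  shows "(\<exists>x y. (a * x + b * y)\<^sup>2 < x * y) \<longleftrightarrow> a * b < 1 / 4"
proof
  assume "\<exists>x y. (a * x + b * y)\<^sup>2 < x * y"
  then obtain x y where xy: "(a * x + b * y)\<^sup>2 < x * y"
    by blast
  then have pos: "x * y > 0"
    using zero_le_power2[of "a * x + b * y"] by linarith
  \<comment> \<open>Dropping the square on the right leaves
    \<open>4 * (a * b) * (x * y) < x * y\<close>, and the positive factor \<open>x * y\<close>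
    cancels.\<close>
  have "(a * x + b * y)\<^sup>2 = (a * x - b * y)\<^sup>2 + 4 * (a * b) * (x * y)"
    by (simp add: power2_eq_square algebra_simps)
  then have "4 * (a * b) * (x * y) < 1 * (x * y)"
    using xy zero_le_power2[of "a * x - b * y"] by linarith
  then show "a * b < 1 / 4"
    using pos mult_less_cancel_right_pos[of "x * y" "4 * (a * b)" 1] by linarith
next
  assume ab: "a * b < 1 / 4"
  show "\<exists>x y. (a * x + b * y)\<^sup>2 < x * y"
  proof (cases "a = 0")
    case True
    \<comment> \<open>On the line \<open>x = 1\<close> the goal is
      \<open>(b * y)\<^sup>2 < y\<close>, that is, \<open>y > 0\<close> and
      \<open>b\<^sup>2 * y < 1\<close>. This choice of \<open>y\<close> works for every
      \<open>b\<close>, including 0.\<close>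
    define t where "t = 1 / (2 * b\<^sup>2 + 1)"
    have pos: "2 * b\<^sup>2 + 1 > 0"
      by (simp add: add_nonneg_pos)
    then have t: "t > 0"
      unfolding t_def by (rule divide_pos_pos[OF zero_less_one])
    have "b\<^sup>2 < 2 * b\<^sup>2 + 1"
      using zero_le_power2[of b] by linarith
    then have "b\<^sup>2 * t < 1"
      unfolding t_def using pos by (simp only: times_divide_eq_right mult_1_right divide_less_eq_1_pos)
    then have "(b * t)\<^sup>2 < t"
      using mult_strict_right_mono[of "b\<^sup>2 * t" 1 t] t by (simp add: power2_eq_square mult_ac)
    then show ?thesis
      using True by (intro exI[of _ 1] exI[of _ t]) simp
  next
    case False
    define x where "x = (1 - 2 * a * b) / (2 * a\<^sup>2)" \<comment> \<open>minimizes the form on the line \<open>y = 1\<close>\<close>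
    have "4 * a\<^sup>2 * (x - (a * x + b)\<^sup>2) = 1 - 4 * (a * b)"
      unfolding x_def using False by (simp add: field_simps power2_eq_square)
    then have "0 < 4 * a\<^sup>2 * (x - (a * x + b)\<^sup>2)"
      using ab by simp
    then have "(a * x + b)\<^sup>2 < x"
      using False by (simp add: zero_less_mult_iff)
    then show ?thesis
      by (intro exI[of _ x] exI[of _ 1]) simp
  qed
qed

lemma linear_on_combination_mod:
  fixes P :: "'a::real_vector \<Rightarrow> real"
  assumes "linear P" "\<And>x. x \<in> N \<Longrightarrow> P x = 0" "v - (a *\<^sub>R u + b *\<^sub>R w) \<in> N"
  shows "P v = a * P u + b * P w"
proof -
  have "P (v - (a *\<^sub>R u + b *\<^sub>R w)) = 0"
    using assms by blast
  then show ?thesis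
    using assms(1) by (simp add: linear_diff linear_add linear_scale)
qed

text \<open>The four conditions are phrased with representatives, so that no cosets occur. If (BC)
  fails, the cases follow whether \<open>e2\<close>, and then \<open>e3\<close>, depends on the
  preceding vectors modulo \<open>N\<close>, and suitable forms are tested. Conversely, each
  condition bounds \<open>P e1 * P e2\<close> by \<open>(P e3)\<^sup>2\<close> for every admissible
  \<open>P\<close>.\<close>

lemma BC_iff_mod:
  fixes e1 e2 e3 :: "real ^ 'n"
  assumes N: "subspace N"
  shows "\<not> BC e1 e2 e3 N \<longleftrightarrow>
      (e1 \<in> N \<or> e2 \<in> N)
    \<or> ((\<forall>a b. a *\<^sub>R e1 + b *\<^sub>R e2 \<in> N \<longrightarrow> a = 0 \<and> b = 0) \<and>
        (\<exists>a b. e3 - (a *\<^sub>R e1 + b *\<^sub>R e2) \<in> N \<and> a * b \<ge> 1 / 4))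
    \<or> (\<exists>\<beta>. e2 - \<beta> *\<^sub>R e1 \<in> N \<and> \<beta> < 0)
    \<or> (\<exists>\<beta> \<gamma>. e2 - \<beta> *\<^sub>R e1 \<in> N \<and> e3 - \<gamma> *\<^sub>R e1 \<in> N \<and> \<beta> \<le> \<gamma>\<^sup>2 \<and> \<beta> \<noteq> 0)"
    (is "_ \<longleftrightarrow> ?degenerate \<or> ?independent \<or> ?opposite \<or> ?collinear")
proof
  have spanN: "span N = N"
    using N by (simp add: span_eq_iff)
  assume nBC: "\<not> BC e1 e2 e3 N"
  have no_form: "\<not> (P e3)\<^sup>2 < P e1 * P e2" if "linear P" "\<And>x. x \<in> N \<Longrightarrow> P x = 0"
    for P :: "real ^ 'n \<Rightarrow> real"
    using nBC that unfolding BC_def by blast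
  show "?degenerate \<or> ?independent \<or> ?opposite \<or> ?collinear"
  proof (cases "?degenerate")
    case False
    then have e1: "e1 \<notin> N" and e2: "e2 \<notin> N"
      by auto
    have form1: "\<exists>P. linear P \<and> (\<forall>x\<in>N. P x = 0) \<and> P e1 = c" for c :: real
      using linear_extend_insert[OF linear_zero, of e1 N c] e1 spanN by metis
    show ?thesis
    proof (cases "e2 \<in> span (insert e1 N)")
      case True
      then obtain \<beta> where \<beta>: "e2 - \<beta> *\<^sub>R e1 \<in> N"
        using spanN by (auto simp: span_breakdown_eq)
      then have \<beta>0: "\<beta> \<noteq> 0"
        using e2 by auto
      have Pe2: "P e2 = \<beta> * P e1" if "linear P" "\<And>x. x \<in> N \<Longrightarrow> P x = 0" for P :: "_ \<Rightarrow> real"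
        using linear_on_combination_mod[OF that, of N e2 \<beta> e1 0 0] \<beta> by simp
      obtain P :: "_ \<Rightarrow> real" where P: "linear P" "\<And>x. x \<in> N \<Longrightarrow> P x = 0" "P e1 = 1"
        using form1 by blast
      show ?thesis
      proof (cases "e3 \<in> span (insert e1 N)")
        case True
        then obtain \<gamma> where \<gamma>: "e3 - \<gamma> *\<^sub>R e1 \<in> N"
          using spanN by (auto simp: span_breakdown_eq)
        have "P e3 = \<gamma>"
          using linear_on_combination_mod[OF P(1,2), of N e3 \<gamma> e1 0 0] \<gamma> P(3) by simp
        then have "\<beta> \<le> \<gamma>\<^sup>2"
          using no_form[OF P(1,2)] Pe2[OF P(1,2)] P(3) by simp
        then show ?thesis
          using \<beta> \<gamma> \<beta>0 by blast
      next
        case False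
        \<comment> \<open>The value at \<open>e3\<close> is free here. Choosing 0 turns the failure
          of (BC) into \<open>\<beta> \<le> 0\<close>.\<close>
        obtain Q where Q: "linear Q" "\<And>x. x \<in> span (insert e1 N) \<Longrightarrow> Q x = P x" "Q e3 = 0"
          using linear_extend_insert[OF P(1) False] by blast
        have QN: "Q x = 0" if "x \<in> N" for x
          using Q(2)[of x] P(2) that by (simp add: span_base)
        have "Q e1 = 1"
          using Q(2)[of e1] P(3) by (simp add: span_base)
        then have "\<beta> \<le> 0"
          using no_form[OF Q(1) QN] Pe2[OF Q(1) QN] Q(3) by simp
        then show ?thesis
          using \<beta> \<beta>0 by force
      qed
    next
      case e2_notin: False
      have form2: "\<exists>P. linear P \<and> (\<forall>x\<in>N. P x = 0) \<and> P e1 = c \<and> P e2 = d" for c d :: real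
      proof -
        obtain P :: "_ \<Rightarrow> real" where P: "linear P" "\<forall>x\<in>N. P x = 0" "P e1 = c"
          using form1 by blast
        obtain Q where "linear Q" "\<And>x. x \<in> span (insert e1 N) \<Longrightarrow> Q x = P x" "Q e2 = d"
          using linear_extend_insert[OF P(1) e2_notin] by blast
        then show ?thesis
          using P by (metis insert_iff span_base)
      qed
      \<comment> \<open>Otherwise the values 1, 1, 0 at \<open>e1\<close>, \<open>e2\<close>,
        \<open>e3\<close> could be prescribed, and \<open>0 < 1\<close> would give (BC).\<close>
      have e3: "e3 \<in> span (insert e2 (insert e1 N))"
      proof (rule ccontr)
        assume e3: "\<not> ?thesis"
        obtain P :: "_ \<Rightarrow> real" where P: "linear P" "\<forall>x\<in>N. P x = 0" "P e1 = 1" "P e2 = 1"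
          using form2 by blast
        obtain Q where Q: "linear Q" "\<And>x. x \<in> span (insert e2 (insert e1 N)) \<Longrightarrow> Q x = P x"
          "Q e3 = 0"
          using linear_extend_insert[OF P(1) e3] by blast
        then have "\<And>x. x \<in> N \<Longrightarrow> Q x = 0" "Q e1 = 1" "Q e2 = 1"
          using P by (simp_all add: span_base)
        then show False
          using no_form[OF Q(1)] Q(3) by simp
      qed
      then obtain a b where "e3 - b *\<^sub>R e2 - a *\<^sub>R e1 \<in> N"
        using spanN by (auto simp: span_breakdown_eq)
      then have ab: "e3 - (a *\<^sub>R e1 + b *\<^sub>R e2) \<in> N"
        by (simp add: diff_diff_add add.commute)
      have "\<not> (a * x + b * y)\<^sup>2 < x * y" for x y
      proof -
        obtain P where P: "linear P" "\<And>x. x \<in> N \<Longrightarrow> P x = 0" "P e1 = x" "P e2 = y"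
          using form2 by blast
        then show ?thesis
          using no_form[OF P(1,2)] linear_on_combination_mod[OF P(1,2) ab] by simp
      qed
      then have "a * b \<ge> 1 / 4"
        using form_negative_iff[of a b] by fastforce
      moreover have "c = 0 \<and> d = 0" if "c *\<^sub>R e1 + d *\<^sub>R e2 \<in> N" for c d
      proof -
        \<comment> \<open>Prescribing the coefficients themselves as values makes \<open>P\<close>
          of the combination a sum of squares.\<close>
        obtain P :: "_ \<Rightarrow> real" where P: "linear P" "\<And>x. x \<in> N \<Longrightarrow> P x = 0" "P e1 = c" "P e2 = d"
          using form2 by blast
        have "c * c + d * d = P (c *\<^sub>R e1 + d *\<^sub>R e2)"
          using P(1,3,4) by (simp add: linear_add linear_scale)
        then have "c * c + d * d = 0"
          using P(2)[OF that] by simp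
        then show ?thesis
          by (simp add: sum_squares_eq_zero_iff)
      qed
      ultimately show ?thesis
        using ab by blast
    qed
  qed blast
next
  assume cond: "?degenerate \<or> ?independent \<or> ?opposite \<or> ?collinear"
  have "\<not> (P e3)\<^sup>2 < P e1 * P e2" if P: "linear P" "\<And>x. x \<in> N \<Longrightarrow> P x = 0"
    for P :: "real ^ 'n \<Rightarrow> real"
  proof -
    note comb = linear_on_combination_mod[where N = N, OF P]
    \<comment> \<open>In both collinear cases the product is a multiple of a square:
      \<open>\<beta> < 0\<close> makes it nonpositive, and
      \<open>\<beta> \<le> \<gamma>\<^sup>2\<close> bounds it by
      \<open>(\<gamma> * P e1)\<^sup>2\<close>, which is \<open>(P e3)\<^sup>2\<close>.\<close>
    have e2: "P e1 * P e2 = \<beta> * (P e1)\<^sup>2" if "e2 - \<beta> *\<^sub>R e1 \<in> N" for \<beta>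
      using comb[of e2 \<beta> e1 0 0] that by (simp add: power2_eq_square)
    have "P e1 * P e2 \<le> (P e3)\<^sup>2"
      using cond
    proof (elim disjE conjE exE)
      fix a b assume "e3 - (a *\<^sub>R e1 + b *\<^sub>R e2) \<in> N" "1 / 4 \<le> a * b"
      then show ?thesis
        using form_negative_iff[of a b] comb by (metis not_less)
    next
      fix \<beta> :: real assume "e2 - \<beta> *\<^sub>R e1 \<in> N" "\<beta> < 0"
      then have "P e1 * P e2 \<le> 0"
        using e2 by (simp add: mult_nonpos_nonneg)
      then show ?thesis
        using zero_le_power2[of "P e3"] by linarith
    next
      fix \<beta> \<gamma> assume "e2 - \<beta> *\<^sub>R e1 \<in> N" "e3 - \<gamma> *\<^sub>R e1 \<in> N" "\<beta> \<le> \<gamma>\<^sup>2"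
      then show ?thesis
        using e2[of \<beta>] comb[of e3 \<gamma> e1 0 0] by (simp add: power_mult_distrib mult_right_mono)
    qed (simp_all add: P)
    then show ?thesis
      by simp
  qed
  then show "\<not> BC e1 e2 e3 N"
    unfolding BC_def by blast
qed

theorem propositionA4:
  fixes e1 e2 e3 :: "real ^ 'n" and N :: "(real ^ 'n) set"
  assumes "subspace N"
  shows "(\<not> BC e1 e2 e3 N) \<longleftrightarrow>
    (let E1 = quot_proj N e1; E2 = quot_proj N e2; E3 = quot_proj N e3 in
       (E1 = N \<or> E2 = N)
     \<or> (quot_independent2 N E1 E2 \<and>
          (\<exists>a b :: real. E3 = quot_scale N a E1 + quot_scale N b E2 \<and> a * b \<ge> 1 / 4))
     \<or> (\<exists>\<beta> :: real. E2 = quot_scale N \<beta> E1 \<and> \<beta> < 0)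
     \<or> (\<exists>\<beta> \<gamma> :: real. E2 = quot_scale N \<beta> E1 \<and> E3 = quot_scale N \<gamma> E1 \<and>
          \<beta> \<le> \<gamma>\<^sup>2 \<and> \<beta> \<noteq> 0))"
proof -
  \<comment> \<open>The zero coset appears as \<open>N\<close> itself and not as an image of
    \<open>quot_proj\<close>, so comparisons with it need their own rule.\<close>
  have eq_N: "quot_proj N v = N \<longleftrightarrow> v \<in> N" for v
    using quot_proj_eq_iff[OF assms, of v 0] by (simp add: quot_proj_0)
  show ?thesis
    unfolding BC_iff_mod[OF assms] quot_independent2_def Let_def
    by (simp only: quot_proj_scale[OF assms] quot_proj_add[OF assms] eq_N
        quot_proj_eq_iff[OF assms])
qed

end
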